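(* For every integer $k\ge1$ and every complex $q$ with $|q|<1$, $$\sum_{\substack{n_k\ge\cdots\ge n_1\ge0\\ l_k\ge\cdots\ge l_1\ge0}}\frac{q^{n_1^2+\cdots+n_k^2+l_1^2+\cdots+l_k^2+n_1l_1}}{(q;q)_{n_k-n_{k-1}}\cdots(q;q)_{n_2-n_1}\,(q;q)_{l_k-l_{k-1}}\cdots(q;q)_{l_2-l_1}}\cdot\frac{1}{(q;q)_{n_1+l_1}(q;q)_{n_1}(q;q)_{l_1}}$$ $$=\frac{1}{(q;q)_\infty}\prod_{\substack{m\ge1\\ m\not\equiv0,\pm2k\ (\mathrm{mod}\ 4k+1)}}\frac{1}{1-q^m}.$$
   Context: Notation: $(x;q)_n=\prod_{j=0}^{n-1}(1-xq^j)$ for integers $n\ge0$, and $(x;q)_\infty=\prod_{j\ge0}(1-xq^j)$. The sum is over integers $n_i,l_i$ ($1\le i\le k$); for $k=1$ the products of difference factors are empty (equal to 1). *)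

theory Defs
  imports "HOL-Analysis.Analysis" "HOL-Number_Theory.Cong"
begin

definition qpoch :: "complex \<Rightarrow> complex \<Rightarrow> nat \<Rightarrow> complex" where
  "qpoch x q n = (\<Prod>j<n. 1 - x * q ^ j)"

definition qpoch_inf :: "complex \<Rightarrow> complex \<Rightarrow> complex" where
  "qpoch_inf x q = (\<Prod>j. 1 - x * q ^ j)"

(* A chain 0 <= n_1 <= ... <= n_k is a function on {1..k}, extensional so that each chain
   occurs exactly once as a summation index. *)
definition weak_chains :: "nat \<Rightarrow> (nat \<Rightarrow> nat) set" where
  "weak_chains k = {n \<in> {1..k} \<rightarrow>\<^sub>E UNIV. mono_on {1..k} n}"

(* For n in weak_chains k the truncated differences n i - n (i - 1) are the true ones. *)
definition summand :: "nat \<Rightarrow> complex \<Rightarrow> (nat \<Rightarrow> nat) \<Rightarrow> (nat \<Rightarrow> nat) \<Rightarrow> complex" where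
  "summand k q n l =
     q ^ ((\<Sum>i=1..k. (n i)\<^sup>2) + (\<Sum>i=1..k. (l i)\<^sup>2) + n 1 * l 1)
       / ((\<Prod>i=2..k. qpoch q q (n i - n (i - 1))) * (\<Prod>i=2..k. qpoch q q (l i - l (i - 1))))
       * (1 / (qpoch q q (n 1 + l 1) * qpoch q q (n 1) * qpoch q q (l 1)))"

definition admissible :: "nat \<Rightarrow> nat \<Rightarrow> bool" where
  "admissible k m \<longleftrightarrow> m \<ge> 1 \<and>
     \<not> [int m = 0] (mod (4 * int k + 1)) \<and>
     \<not> [int m = 2 * int k] (mod (4 * int k + 1)) \<and>
     \<not> [int m = - 2 * int k] (mod (4 * int k + 1))"

definition product_side :: "nat \<Rightarrow> complex \<Rightarrow> complex" where
  "product_side k q = (\<Prod>m. if admissible k m then 1 / (1 - q ^ m) else 1)"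

(* Both infinite products converge for norm q < 1, so the values above are genuine limits. *)

lemma convergent_qpoch_inf:
  fixes q :: complex
  assumes "norm q < 1"
  shows "convergent_prod (\<lambda>j. 1 - x * q ^ j)"
proof -
  have "summable (\<lambda>j. norm x * norm q ^ j)"
    using assms by (intro summable_mult summable_geometric) auto
  then have "summable (\<lambda>j. norm ((1 - x * q ^ j) - 1))"
    by (simp add: norm_mult norm_power)
  then show ?thesis
    using abs_convergent_prod_conv_summable abs_convergent_prod_imp_convergent_prod by blast
qed

lemma convergent_product_side:
  fixes q :: complex
  assumes "norm q < 1"
  shows "convergent_prod (\<lambda>m. if admissible k m then 1 / (1 - q ^ m) else 1)"
proof -
  let ?g = "\<lambda>m. if admissible k m then 1 - q ^ m else 1"
  have "summable (\<lambda>m. norm (?g m - 1))"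
  proof (rule summable_comparison_test')
    show "summable (\<lambda>m. norm q ^ m)" using assms by (intro summable_geometric) auto
    show "norm (norm (?g m - 1)) \<le> norm q ^ m" if "m \<ge> 0" for m by (simp add: norm_power)
  qed
  then have "convergent_prod ?g"
    using abs_convergent_prod_conv_summable abs_convergent_prod_imp_convergent_prod by blast
  then have "convergent_prod (\<lambda>m. inverse (?g m))"
    by (rule convergent_prod_inverse)
  moreover have "(\<lambda>m. inverse (?g m)) = (\<lambda>m. if admissible k m then 1 / (1 - q ^ m) else 1)"
    by (auto simp: divide_simps)
  ultimately show ?thesis by simp
qed

end

theory Submission
  imports Defs
begin

text \<open>
  The coupling factor of the two chains is diagonalised by the Bailey kernel
  u(n,r) = 1 / ((q;q)_(n-r) (q;q)_(n+r)): a terminating very-well-poised sum gives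
  q^(nl) / ((q;q)_(n+l) (q;q)_n (q;q)_l) as the sum over r of a(r) u(n,r) u(l,r), where
  a(0) = 1 and a(r) = (-1)^r q^(r(r-1)/2) (1 + q^r).
  For fixed r the sum over the two chains then factors, and the Bailey chain (an iterated
  q-Vandermonde sum) evaluates each factor to q^(k r^2) / (q;q)_inf.  The exchange of summations
  is harmless because the a(r) are already absolutely summable.  The remaining series
  of a(r) q^(2k r^2) is a theta series, which the Jacobi triple product with a = q^(2k),
  b = q^(2k+1) and base ab = q^(4k+1) turns into the missing factors of the product.
\<close>

subsection \<open>Diagonalisation of the coupling factor\<close>

text \<open>The kernel is the right basis because, for fixed r, it is an eigenvector of every
  summation inside a chain: weighting by q^(j^2) / (q;q)_(n-j) and summing over j multiplies it by
  q^(r^2). Once the factor linking n_1 and l_1 is expanded in kernels, each of the 2k summations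
  contributes q^(r^2), and the unbounded one in each chain also 1/(q;q)_inf; this is where 2k r^2
  comes from. The kernel is also a q-binomial coefficient, u(n,r) = [2n choose n-r] / (q;q)_(2n), so
  in base ab it carries a finite form of the triple product, and one bound and one limit theorem
  serve both uses. No step divides by q, so q = 0 is included.\<close>

lemma qpoch_0 [simp]: "qpoch x q 0 = 1"
  by (simp add: qpoch_def)

lemma qpoch_Suc: "qpoch x q (Suc n) = qpoch x q n * (1 - x * q ^ n)"
  by (simp add: qpoch_def)

lemma norm_power_less_one:
  fixes q :: complex
  assumes "norm q < 1" and "n > 0"
  shows "norm (q ^ n) < 1"
  unfolding norm_power using assms by (simp only: power_less_one_iff norm_ge_zero)

lemma one_minus_power_nonzero:
  fixes q :: complex
  assumes "norm q < 1" and "n > 0"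
  shows "1 - q ^ n \<noteq> 0"
  using norm_power_less_one[OF assms] by auto

lemma qpoch_nonzero:
  fixes q :: complex
  assumes "norm q < 1"
  shows "qpoch q q n \<noteq> 0"
  using one_minus_power_nonzero[OF assms, of "Suc j" for j] by (simp add: qpoch_def)

text \<open>Encodes the convention 1/(q;q)_m = 0 for m < 0; truncated subtraction alone would give 1
  when r > n. These zeros make the sums over r finite and kill the boundary terms of the telescoping
  sums.\<close>

definition recip_qpoch :: "complex \<Rightarrow> nat \<Rightarrow> nat \<Rightarrow> complex" where
  "recip_qpoch q n r = (if r \<le> n then 1 / qpoch q q (n - r) else 0)"

definition bailey_kernel :: "complex \<Rightarrow> nat \<Rightarrow> nat \<Rightarrow> complex" where
  "bailey_kernel q n r = recip_qpoch q n r / qpoch q q (n + r)"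

text \<open>
  The coefficients are those of a bilateral sum folded at 0: the summand q^(r(r+1)/2) at r
  and the one at -r add up to q^(r(r-1)/2) (1 + q^r).
\<close>
definition dixon_coeff :: "complex \<Rightarrow> nat \<Rightarrow> complex" where
  "dixon_coeff q r = (if r = 0 then 1 else (-1) ^ r * q ^ (r * (r - 1) div 2) * (1 + q ^ r))"

lemma recip_qpoch_Suc_right:
  assumes "norm q < 1" and "r \<le> n"
  shows "recip_qpoch q n (Suc r) = (1 - q ^ (n - r)) * recip_qpoch q n r"
proof (cases "r = n")
  case False
  then obtain d where d: "n = r + Suc d" using assms(2) less_imp_Suc_add[of r n] by auto
  show ?thesis
    using qpoch_nonzero[OF assms(1), of d] one_minus_power_nonzero[OF assms(1), of "Suc d"]
    by (simp add: d recip_qpoch_def qpoch_Suc field_simps)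
qed (simp add: recip_qpoch_def)

lemma recip_qpoch_Suc_left:
  assumes "norm q < 1" and "r \<le> Suc n"
  shows "recip_qpoch q n r = (1 - q ^ (Suc n - r)) * recip_qpoch q (Suc n) r"
proof (cases "r = Suc n")
  case False
  then have "r \<le> n" using assms(2) by simp
  then obtain d where d: "n = r + d" using le_Suc_ex by auto
  show ?thesis
    using qpoch_nonzero[OF assms(1), of d] one_minus_power_nonzero[OF assms(1), of "Suc d"]
    by (simp add: d recip_qpoch_def qpoch_Suc Suc_diff_le field_simps)
qed (simp add: recip_qpoch_def)

lemma triangular_Suc: "Suc r * r div 2 = r * (r - 1) div 2 + (r::nat)"
proof (cases r)
  case (Suc m)
  have "Suc r * r = r * (r - 1) + 2 * r" using Suc by (simp add: algebra_simps)
  then show ?thesis by simp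
qed simp

text \<open>
  The coupling factor, as a function of n, satisfies a first-order recurrence.  Applying this recurrence
  to the individual summands gives a telescoping sum, whose boundary term was found by a
  WZ-style ansatz and vanishes beyond the support of the kernel.
\<close>
lemma dixon_partial_sum:
  fixes q :: complex
  assumes q: "norm q < 1" and "R \<le> Suc n"
  shows "(\<Sum>r\<le>R. dixon_coeff q r *
            ((1 - q ^ Suc n) * (1 - q ^ (Suc n + l)) * bailey_kernel q (Suc n) r
              - q ^ l * bailey_kernel q n r) * bailey_kernel q l r)
         = (-1) ^ R * q ^ (Suc R * R div 2) * recip_qpoch q (Suc n) (Suc R) * recip_qpoch q l (Suc R)
            / (qpoch q q (Suc n + R) * qpoch q q (l + R))"
  using assms(2)
proof (induction R)
  case 0
  have "1 / (p * p) = z\<^sup>2 * (1 / (p * z * (p * z)))" if "p \<noteq> 0" "z \<noteq> 0" for p z :: complex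
    using that by (simp add: power2_eq_square)
  from this[of "qpoch q q n" "1 - q ^ Suc n"]
  have "bailey_kernel q n 0 = (1 - q ^ Suc n)\<^sup>2 * bailey_kernel q (Suc n) 0"
    using qpoch_nonzero[OF q, of n] one_minus_power_nonzero[OF q, of "Suc n"]
    by (simp add: bailey_kernel_def recip_qpoch_def qpoch_Suc)
  moreover
  have "((1 - z) * (1 - z * b) * (E / P) - b * ((1 - z)\<^sup>2 * (E / P))) * (F / P')
      = (1 - z) * E * ((1 - b) * F) / (P * P')" for z b E F P P' :: complex
    by (simp add: divide_inverse power2_eq_square algebra_simps)
  note this[of "q ^ Suc n" "q ^ l" "recip_qpoch q (Suc n) 0" "qpoch q q (Suc n)"
      "recip_qpoch q l 0" "qpoch q q l"]
  ultimately show ?case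
    using recip_qpoch_Suc_right[OF q, of 0 "Suc n"] recip_qpoch_Suc_right[OF q, of 0 l]
    by (simp add: dixon_coeff_def power_add bailey_kernel_def mult.assoc)
next
  case (Suc R)
  show ?case
  proof (cases "Suc R \<le> l")
    case False
    then show ?thesis using Suc by (simp add: bailey_kernel_def recip_qpoch_def)
  next
    case True
    define r where "r = Suc R"
    define A where "A = recip_qpoch q (Suc n) r"
    define B where "B = recip_qpoch q l r"
    define P where "P = qpoch q q (Suc n + r)"
    define P' where "P' = qpoch q q (l + r)"
    \<comment> \<open>All powers of q involved are monomials in these three: q^(n+1) = a x, q^l = b
      x, q^(n+1+r) = a x^2, q^(l+r) = b x^2. With t A B / (P P') factored out, the induction step is
      a polynomial identity in a, b, x.\<close>
    define x where "x = q ^ r"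
    define a where "a = q ^ (Suc n - r)"
    define b where "b = q ^ (l - r)"
    define t where "t = (-1) ^ R * q ^ (r * (r - 1) div 2)"
    have rn: "r \<le> Suc n" "r \<le> l" using Suc.prems True by (auto simp: r_def)
    have qn: "q ^ Suc n = a * x" using rn by (simp add: a_def x_def flip: power_add)
    have ql: "q ^ l = b * x" using rn by (simp add: b_def x_def flip: power_add)
    have qnr: "q ^ (Suc n + r) = a * x * x" unfolding power_add qn x_def by simp
    have qlr: "q ^ (l + r) = b * x * x" unfolding power_add ql x_def by simp
    have nz: "P \<noteq> 0" "P' \<noteq> 0" by (auto simp: P_def P'_def qpoch_nonzero[OF q])
    have PR: "P = qpoch q q (Suc n + R) * (1 - a * x * x)"
      unfolding P_def r_def using qnr by (simp add: qpoch_Suc r_def)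
    have PR': "P' = qpoch q q (l + R) * (1 - b * x * x)"
      unfolding P'_def r_def using qlr by (simp add: qpoch_Suc r_def)
    have un: "bailey_kernel q n r = (1 - a) * (1 - a * x * x) * A / P"
    proof -
      have "P = qpoch q q (n + r) * (1 - a * x * x)"
        unfolding P_def using qnr by (simp add: qpoch_Suc)
      moreover have "1 - a * x * x \<noteq> 0" using calculation nz by auto
      ultimately show ?thesis
        unfolding bailey_kernel_def recip_qpoch_Suc_left[OF q rn(1)] A_def[symmetric] a_def[symmetric]
        by simp
    qed
    have prev: "recip_qpoch q (Suc n) (Suc R) * recip_qpoch q l (Suc R) / (qpoch q q (Suc n + R) * qpoch q q (l + R))
      = A * B * (1 - a * x * x) * (1 - b * x * x) / (P * P')"
    proof -
      have "C / (X * Y) = C * u * v / ((X * u) * (Y * v))" if "u \<noteq> 0" "v \<noteq> 0" for C X Y u v :: complex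
        using that by simp
      then show ?thesis using nz unfolding PR PR' A_def B_def r_def by simp
    qed
    have "(\<Sum>r\<le>Suc R. dixon_coeff q r *
            ((1 - q ^ Suc n) * (1 - q ^ (Suc n + l)) * bailey_kernel q (Suc n) r
              - q ^ l * bailey_kernel q n r) * bailey_kernel q l r)
      = t * (A * B * (1 - a * x * x) * (1 - b * x * x) / (P * P'))
        + dixon_coeff q r * ((1 - a * x) * (1 - a * x * (b * x)) * (A / P)
            - b * x * ((1 - a) * (1 - a * x * x) * A / P)) * (B / P')"
    proof -
      have 1: "bailey_kernel q (Suc n) r = A / P" "bailey_kernel q l r = B / P'"
        by (simp_all add: bailey_kernel_def A_def B_def P_def P'_def)
      have 2: "1 - q ^ (Suc n + l) = 1 - a * x * (b * x)" unfolding power_add qn ql ..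
      have 3: "(\<Sum>r\<le>R. dixon_coeff q r *
            ((1 - q ^ Suc n) * (1 - q ^ (Suc n + l)) * bailey_kernel q (Suc n) r
              - q ^ l * bailey_kernel q n r) * bailey_kernel q l r)
          = t * (recip_qpoch q (Suc n) (Suc R) * recip_qpoch q l (Suc R) / (qpoch q q (Suc n + R) * qpoch q q (l + R)))"
        using Suc by (simp add: t_def r_def)
      show ?thesis unfolding sum.atMost_Suc 3 prev unfolding r_def[symmetric] un 1 2 qn ql ..
    qed
    also have "\<dots> = - t * x * ((1 - a) * A) * ((1 - b) * B) / (P * P')"
    proof -
      have d: "dixon_coeff q r = - t * (1 + x)" by (simp add: dixon_coeff_def t_def x_def r_def)
      show ?thesis unfolding d using nz by (simp add: divide_simps) algebra
    qed
    also have "\<dots> = (-1) ^ r * q ^ (Suc r * r div 2) * recip_qpoch q (Suc n) (Suc r) * recip_qpoch q l (Suc r)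
            / (qpoch q q (Suc n + r) * qpoch q q (l + r))"
      unfolding recip_qpoch_Suc_right[OF q rn(1)] recip_qpoch_Suc_right[OF q rn(2)] triangular_Suc power_add
      by (simp add: t_def A_def B_def a_def b_def P_def P'_def x_def r_def)
    finally show ?thesis by (simp add: r_def)
  qed
qed

text \<open>Both sides obey the same recurrence in n, since for R = n + 1 the boundary term of
  \<open>dixon_partial_sum\<close> contains 1/(q;q)_(-1) = 0. The bound M stays fixed so that the
  sums for n and n + 1 have a common range. Classically this is the q-Dixon sum with one parameter
  sent to infinity and q replaced by 1/q.\<close>

theorem dixon_sum:
  fixes q :: complex
  assumes q: "norm q < 1"
  shows "n \<le> M \<Longrightarrow> (\<Sum>r\<le>M. dixon_coeff q r * bailey_kernel q n r * bailey_kernel q l r)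
         = q ^ (n * l) / (qpoch q q (n + l) * qpoch q q n * qpoch q q l)"
proof (induction n)
  case 0
  have "(\<Sum>r\<le>M. dixon_coeff q r * bailey_kernel q 0 r * bailey_kernel q l r)
      = (\<Sum>r\<in>{0}. dixon_coeff q r * bailey_kernel q 0 r * bailey_kernel q l r)"
    by (rule sum.mono_neutral_right) (auto simp: bailey_kernel_def recip_qpoch_def)
  then show ?case by (simp add: dixon_coeff_def bailey_kernel_def recip_qpoch_def)
next
  case (Suc n)
  define T where "T = (\<Sum>r\<le>M. dixon_coeff q r * bailey_kernel q (Suc n) r * bailey_kernel q l r)"
  have trunc: "(\<Sum>r\<le>M. dixon_coeff q r *
            ((1 - q ^ Suc n) * (1 - q ^ (Suc n + l)) * bailey_kernel q (Suc n) r
              - q ^ l * bailey_kernel q n r) * bailey_kernel q l r)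
     = (\<Sum>r\<le>Suc n. dixon_coeff q r *
            ((1 - q ^ Suc n) * (1 - q ^ (Suc n + l)) * bailey_kernel q (Suc n) r
              - q ^ l * bailey_kernel q n r) * bailey_kernel q l r)"
    using Suc.prems by (intro sum.mono_neutral_right) (auto simp: bailey_kernel_def recip_qpoch_def)
  also have "\<dots> = 0"
    unfolding dixon_partial_sum[OF q order_refl] by (simp add: recip_qpoch_def)
  finally have "(1 - q ^ Suc n) * (1 - q ^ (Suc n + l)) * T
      - q ^ l * (\<Sum>r\<le>M. dixon_coeff q r * bailey_kernel q n r * bailey_kernel q l r) = 0"
    unfolding T_def sum_distrib_left sum_subtractf[symmetric] by (simp add: algebra_simps)
  then have "(1 - q ^ Suc n) * (1 - q ^ (Suc n + l)) * T
      = q ^ l * (q ^ (n * l) / (qpoch q q (n + l) * qpoch q q n * qpoch q q l))"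
    using Suc by simp
  moreover have "1 - q ^ Suc n \<noteq> 0" "1 - q ^ (Suc n + l) \<noteq> 0"
    by (rule one_minus_power_nonzero[OF q]; simp)+
  moreover have "T = w * c / ((A * v) * (B * u) * L)"
    if "u * v * T = w * (c / (A * B * L))" "u \<noteq> 0" "v \<noteq> 0" "A \<noteq> 0" "B \<noteq> 0" "L \<noteq> 0" for u v w c A B L
    using that by (simp add: divide_simps) (simp add: mult_ac)
  ultimately have "T = q ^ l * q ^ (n * l) / ((qpoch q q (n + l) * (1 - q ^ (Suc n + l))) * (qpoch q q n * (1 - q ^ Suc n)) * qpoch q q l)"
    using qpoch_nonzero[OF q] by blast
  then show ?case by (simp add: T_def qpoch_Suc power_add)
qed

section \<open>q-Vandermonde and a single Bailey step\<close>

lemma q_vandermonde: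
  fixes q :: complex
  assumes q: "norm q < 1"
  shows "(\<Sum>i\<le>N. q ^ (i\<^sup>2 + c * i) / (qpoch q q (N - i) * qpoch q q i * qpoch q q (i + c)))
         = 1 / (qpoch q q N * qpoch q q (N + c))"
\<comment> \<open>Lowering N shifts i by one and thereby turns c into c + 1, so c must stay free.
  \<open>bailey_step\<close> uses c = 2r.\<close>
proof (induction N arbitrary: c)
  case 0
  then show ?case by simp
next
  case (Suc N)
  note nz = qpoch_nonzero[OF q]
  define f where "f c M i = q ^ (i\<^sup>2 + c * i) / (qpoch q q (M - i) * qpoch q q i * qpoch q q (i + c))" for c M i
  have nzs: "1 - q * q ^ m \<noteq> 0" for m using one_minus_power_nonzero[OF q, of "Suc m"] by simp
  \<comment> \<open>Splitting 1 - q^(N+1) = (1 - q^(N+1-i)) + q^(N+1-i) (1 - q^i) reduces N by one.\<close>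
  have "(1 - q ^ Suc N) * (\<Sum>i\<le>Suc N. f c (Suc N) i)
      = (\<Sum>i\<le>Suc N. (1 - q ^ (Suc N - i)) * f c (Suc N) i)
        + (\<Sum>i\<le>Suc N. q ^ (Suc N - i) * (1 - q ^ i) * f c (Suc N) i)"
    unfolding sum_distrib_left sum.distrib[symmetric]
  proof (rule sum.cong[OF refl])
    fix i assume "i \<in> {..Suc N}"
    then have "q ^ Suc N = q ^ (Suc N - i) * q ^ i" by (simp flip: power_add)
    then show "(1 - q ^ Suc N) * f c (Suc N) i = (1 - q ^ (Suc N - i)) * f c (Suc N) i
       + q ^ (Suc N - i) * (1 - q ^ i) * f c (Suc N) i" by (simp add: algebra_simps)
  qed
  \<comment> \<open>The factor 1 - q^(N+1-i) removes i = N + 1 here; in the second sum 1 - q^i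
    removes i = 0, so the shift i -> i + 1 leaves a full sum over i <= N.\<close>
  also have "(\<Sum>i\<le>Suc N. (1 - q ^ (Suc N - i)) * f c (Suc N) i) = (\<Sum>i\<le>N. f c N i)"
    using nz nzs by (auto intro!: sum.cong simp: f_def Suc_diff_le qpoch_Suc)
  also have "(\<Sum>i\<le>Suc N. q ^ (Suc N - i) * (1 - q ^ i) * f c (Suc N) i)
      = (\<Sum>i\<le>N. q ^ (Suc N + c) * f (Suc c) N i)"
  proof -
    have "q ^ (N - i) * (1 - q * q ^ i) * f c (Suc N) (Suc i) = q ^ (Suc N + c) * f (Suc c) N i"
      if "i \<le> N" for i
    proof -
      have "N - i + ((Suc i)\<^sup>2 + c * Suc i) = (Suc N + c) + (i\<^sup>2 + Suc c * i)"
        using that by (simp add: power2_eq_square algebra_simps)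
      then have "q ^ (N - i) * q ^ ((Suc i)\<^sup>2 + c * Suc i) = q ^ (Suc N + c) * q ^ (i\<^sup>2 + Suc c * i)"
        by (metis power_add)
      moreover have "Y * v * (E / (D * (p * v) * p')) = F / (D * p * p')"
        if "Y * E = F" "v \<noteq> 0" for Y v E D p p' F :: complex
        using that by (simp add: field_simps)
      ultimately show ?thesis using nzs[of i] unfolding f_def
        by (simp add: qpoch_Suc[of q q i])
    qed
    then show ?thesis by (simp only: sum.atMost_Suc_shift) (auto intro!: sum.cong)
  qed
  finally have *: "(1 - q ^ Suc N) * (\<Sum>i\<le>Suc N. f c (Suc N) i)
     = 1 / (qpoch q q N * qpoch q q (N + c)) + q ^ (Suc N + c) * (1 / (qpoch q q N * qpoch q q (N + Suc c)))"
    using Suc unfolding f_def[symmetric] by (simp only: sum_distrib_left[symmetric])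
  have "\<dots> = 1 / (qpoch q q N * qpoch q q (N + c))
      * (1 + q ^ (Suc N + c) / (1 - q ^ (Suc N + c)))"
    using nz nzs[of "N + c"] by (simp add: qpoch_Suc field_simps)
  also have "1 + q ^ (Suc N + c) / (1 - q ^ (Suc N + c)) = 1 / (1 - q ^ (Suc N + c))"
    using nzs[of "N + c"] by (simp add: field_simps)
  finally have "(1 - q ^ Suc N) * (\<Sum>i\<le>Suc N. f c (Suc N) i) = 1 / (qpoch q q N * qpoch q q (Suc N + c))"
    using * by (simp add: qpoch_Suc)
  moreover have "S = 1 / (p * z * P)" if "z * S = 1 / (p * P)" "z \<noteq> 0" for S p z P :: complex
    using that by (metis (no_types, lifting) divide_divide_eq_left mult.assoc mult.commute nonzero_mult_div_cancel_left)
  ultimately have "(\<Sum>i\<le>Suc N. f c (Suc N) i) = 1 / (qpoch q q N * (1 - q ^ Suc N) * qpoch q q (Suc N + c))"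
    using nzs[of N] by simp
  then show ?case by (simp add: f_def qpoch_Suc)
qed

text \<open>Only j >= r contribute, and for j = r + i the exponent splits as r^2 + (i^2 + 2ri),
  which is q-Vandermonde with offset 2r. Because the kernel reproduces itself up to q^(r^2), the
  step can be iterated along a chain.\<close>

lemma bailey_step:
  fixes q :: complex
  assumes q: "norm q < 1"
  shows "(\<Sum>j\<le>n. q ^ (j\<^sup>2) * bailey_kernel q j r / qpoch q q (n - j)) = q ^ (r\<^sup>2) * bailey_kernel q n r"
proof (cases "r \<le> n")
  case False
  then show ?thesis by (simp add: bailey_kernel_def recip_qpoch_def)
next
  case True
  then obtain N where N: "n = r + N" using le_Suc_ex by auto
  have "(\<Sum>j\<le>n. q ^ (j\<^sup>2) * bailey_kernel q j r / qpoch q q (n - j))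
      = (\<Sum>j\<in>{r..n}. q ^ (j\<^sup>2) * bailey_kernel q j r / qpoch q q (n - j))"
    by (rule sum.mono_neutral_right) (auto simp: bailey_kernel_def recip_qpoch_def)
  also have "\<dots> = (\<Sum>i\<le>N. q ^ ((r + i)\<^sup>2) * bailey_kernel q (r + i) r / qpoch q q (n - (r + i)))"
    by (rule sum.reindex_bij_witness[of _ "\<lambda>i. r + i" "\<lambda>j. j - r"]) (auto simp: N)
  also have "\<dots> = q ^ (r\<^sup>2) * (\<Sum>i\<le>N. q ^ (i\<^sup>2 + 2 * r * i) / (qpoch q q (N - i) * qpoch q q i * qpoch q q (i + 2 * r)))"
    unfolding sum_distrib_left
  proof (rule sum.cong[OF refl])
    fix i
    have "(r + i)\<^sup>2 = r\<^sup>2 + (i\<^sup>2 + 2 * r * i)" by (simp add: power2_eq_square algebra_simps)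
    moreover have "qpoch q q (r + i + r) = qpoch q q (i + 2 * r)" by (simp add: mult_2 add_ac)
    ultimately show "q ^ ((r + i)\<^sup>2) * bailey_kernel q (r + i) r / qpoch q q (n - (r + i))
      = q ^ (r\<^sup>2) * (q ^ (i\<^sup>2 + 2 * r * i) / (qpoch q q (N - i) * qpoch q q i * qpoch q q (i + 2 * r)))"
      by (simp add: N bailey_kernel_def recip_qpoch_def power_add)
  qed
  also have "\<dots> = q ^ (r\<^sup>2) * bailey_kernel q n r"
    unfolding q_vandermonde[OF q] by (simp add: bailey_kernel_def recip_qpoch_def N mult_2 add_ac)
  finally show ?thesis .
qed

subsection \<open>The limiting Bailey lemma\<close>

lemma qpoch_LIMSEQ:
  assumes "norm q < 1"
  shows "qpoch x q \<longlonglongrightarrow> qpoch_inf x q"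
  using has_prod_imp_tendsto'[OF convergent_prod_has_prod[OF convergent_qpoch_inf[OF assms, of x]]]
  by (simp add: qpoch_def[abs_def] qpoch_inf_def)

lemma qpoch_inf_nonzero:
  assumes "norm q < 1"
  shows "qpoch_inf q q \<noteq> 0"
  unfolding qpoch_inf_def
  using one_minus_power_nonzero[OF assms, of "Suc j" for j]
  by (intro prodinf_nonzero convergent_qpoch_inf[OF assms]) auto

text \<open>The reciprocals converge because (q;q)_inf is nonzero, hence they are bounded.
  Uniformity in both indices is what the later dominated-convergence and comparison arguments
  need.\<close>

lemma recip_qpoch_bounded:
  assumes "norm q < 1"
  obtains C where "C > 0" "\<And>n. norm (1 / qpoch q q n) \<le> C" "\<And>n r. norm (recip_qpoch q n r) \<le> C"
    "\<And>n r. norm (bailey_kernel q n r) \<le> C * C"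
proof -
  have "(\<lambda>n. 1 / qpoch q q n) \<longlonglongrightarrow> 1 / qpoch_inf q q"
    by (intro tendsto_intros qpoch_LIMSEQ assms qpoch_inf_nonzero)
  then have "Bseq (\<lambda>n. 1 / qpoch q q n)"
    by (intro convergent_imp_Bseq) (auto simp: convergent_def)
  then obtain C where C: "C > 0" "\<And>n. norm (1 / qpoch q q n) \<le> C"
    by (auto simp: Bseq_def)
  have r: "norm (recip_qpoch q n r) \<le> C" for n r
    using C by (auto simp: recip_qpoch_def less_imp_le)
  have "norm (bailey_kernel q n r) \<le> C * C" for n r
  proof -
    have "norm (recip_qpoch q n r) * norm (1 / qpoch q q (n + r)) \<le> C * C"
      by (rule mult_mono[OF r C(2)]) (use C(1) in auto)
    then show ?thesis
      by (simp add: bailey_kernel_def norm_divide)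
  qed
  with C r show ?thesis using that by blast
qed

lemma recip_qpoch_LIMSEQ:
  assumes "norm q < 1"
  shows "(\<lambda>n. recip_qpoch q n r) \<longlonglongrightarrow> 1 / qpoch_inf q q"
proof (rule LIMSEQ_offset)
  show "(\<lambda>n. recip_qpoch q (n + r) r) \<longlonglongrightarrow> 1 / qpoch_inf q q"
    unfolding recip_qpoch_def by (simp, intro tendsto_intros qpoch_LIMSEQ assms qpoch_inf_nonzero)
qed

lemma bailey_kernel_LIMSEQ:
  assumes "norm q < 1"
  shows "(\<lambda>n. bailey_kernel q n r) \<longlonglongrightarrow> 1 / (qpoch_inf q q)\<^sup>2"
proof -
  have "(\<lambda>n. recip_qpoch q n r / qpoch q q (n + r)) \<longlonglongrightarrow> 1 / qpoch_inf q q / qpoch_inf q q"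
    by (intro tendsto_divide recip_qpoch_LIMSEQ LIMSEQ_ignore_initial_segment qpoch_LIMSEQ assms qpoch_inf_nonzero)
  then show ?thesis by (simp add: bailey_kernel_def power2_eq_square)
qed

text \<open>Tannery's theorem with majorant C |f j|: as \<open>g n j\<close> vanishes for j > n, the
  moving upper limit of the sum is harmless. It is applied with g = \<open>recip_qpoch q\<close> and
  with g = \<open>bailey_kernel Q\<close>.\<close>

lemma triangular_sum_LIMSEQ:
  fixes f :: "nat \<Rightarrow> complex"
  assumes "summable (\<lambda>j. norm (f j))" and lim: "\<And>j. (\<lambda>n. g n j) \<longlonglongrightarrow> L"
    and bound: "\<And>n j. norm (g n j) \<le> C" and zero: "\<And>n j. j > n \<Longrightarrow> g n j = 0"
  shows "(\<lambda>n. \<Sum>j\<le>n. f j * g n j) \<longlonglongrightarrow> suminf f * L"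
proof -
  have lim': "(\<lambda>n. f j * g n j) \<longlonglongrightarrow> f j * L" for j by (intro tendsto_mult tendsto_const lim)
  have "norm (f j * g n j) \<le> norm (f j) * C" for j n
    by (simp add: norm_mult mult_left_mono bound)
  then have bound': "eventually (\<lambda>(j, n). norm (f j * g n j) \<le> norm (f j) * C) (at_top \<times>\<^sub>F at_top)"
    by (intro always_eventually) auto
  have "(\<lambda>n. suminf (\<lambda>j. f j * g n j)) \<longlonglongrightarrow> suminf (\<lambda>j. f j * L)"
    using tannerys_theorem[where a = "\<lambda>j n. f j * g n j" and b = "\<lambda>j. f j * L",
      OF lim' bound' summable_mult2[OF assms(1)] trivial_limit_sequentially] by blast
  moreover have "suminf (\<lambda>j. f j * g n j) = (\<Sum>j\<le>n. f j * g n j)" for n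
    by (rule suminf_finite) (auto simp: zero)
  moreover have "suminf (\<lambda>j. f j * L) = suminf f * L"
    by (rule suminf_mult2[symmetric, OF summable_norm_cancel[OF assms(1)]])
  ultimately show ?thesis by simp
qed

lemma summable_power_square:
  fixes x :: real
  assumes "0 \<le> x" "x < 1"
  shows "summable (\<lambda>j. x ^ (j\<^sup>2))"
proof (rule summable_comparison_test')
  show "summable (\<lambda>j. x ^ j)" using assms by (intro summable_geometric) auto
  show "norm (x ^ (j\<^sup>2)) \<le> x ^ j" if "j \<ge> 0" for j
    using assms by (auto simp: power2_eq_square intro!: power_decreasing)
qed

text \<open>Let n tend to infinity in \<open>bailey_step\<close>: the weights tend to 1/(q;q)_inf,
  the kernel on the right to 1/(q;q)_inf^2, and one factor cancels. This handles the largest,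
  unbounded entry of a chain.\<close>

lemma bailey_limit:
  fixes q :: complex
  assumes q: "norm q < 1"
  shows "((\<lambda>j. q ^ (j\<^sup>2) * bailey_kernel q j r) has_sum (q ^ (r\<^sup>2) / qpoch_inf q q)) UNIV"
proof -
  obtain C where C: "C > 0" "\<And>n r. norm (recip_qpoch q n r) \<le> C"
    "\<And>n r. norm (bailey_kernel q n r) \<le> C * C"
    using recip_qpoch_bounded[OF q] by metis
  define f where "f j = q ^ (j\<^sup>2) * bailey_kernel q j r" for j
  have sf: "summable (\<lambda>j. norm (f j))"
  proof (rule summable_comparison_test')
    show "summable (\<lambda>j. norm q ^ (j\<^sup>2) * (C * C))"
      using q by (intro summable_mult2 summable_power_square) auto
    show "norm (norm (f j)) \<le> norm q ^ (j\<^sup>2) * (C * C)" if "j \<ge> 0" for j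
      by (simp add: f_def norm_mult norm_power mult_left_mono[OF C(3)])
  qed
  have "(\<lambda>n. \<Sum>j\<le>n. f j * recip_qpoch q n j) \<longlonglongrightarrow> suminf f * (1 / qpoch_inf q q)"
    by (rule triangular_sum_LIMSEQ[where g = "recip_qpoch q", OF sf recip_qpoch_LIMSEQ[OF q] C(2)]) (simp add: recip_qpoch_def)
  moreover have "(\<Sum>j\<le>n. f j * recip_qpoch q n j) = q ^ (r\<^sup>2) * bailey_kernel q n r" for n
    unfolding bailey_step[OF q, where n = n and r = r, symmetric]
    by (intro sum.cong) (auto simp: f_def recip_qpoch_def)
  moreover have "(\<lambda>n. q ^ (r\<^sup>2) * bailey_kernel q n r) \<longlonglongrightarrow> q ^ (r\<^sup>2) * (1 / (qpoch_inf q q)\<^sup>2)"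
    by (intro tendsto_intros bailey_kernel_LIMSEQ q)
  ultimately have "suminf f * (1 / qpoch_inf q q) = q ^ (r\<^sup>2) * (1 / (qpoch_inf q q)\<^sup>2)"
    by (simp only:) (rule LIMSEQ_unique)
  then have "suminf f = q ^ (r\<^sup>2) / qpoch_inf q q"
    using qpoch_inf_nonzero[OF q] by (simp add: field_simps power2_eq_square)
  moreover have "f sums suminf f"
    by (rule summable_sums[OF summable_norm_cancel[OF sf]])
  ultimately have "(f has_sum (q ^ (r\<^sup>2) / qpoch_inf q q)) UNIV"
    using norm_summable_imp_has_sum[OF sf] by simp
  then show ?thesis by (simp add: f_def[abs_def])
qed

subsection \<open>The Jacobi triple product\<close>

text \<open>
  In the bilateral series with summand (-z)^j Q^(j(j-1)/2), put z = a and Q / z = b.  The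
  terms with j = r and j = -r become polynomials in a and b, so that no inverse powers occur and
  the case q = 0 needs no separate treatment.
\<close>
definition theta_half :: "complex \<Rightarrow> complex \<Rightarrow> nat \<Rightarrow> complex" where
  "theta_half a b r = (-1) ^ r * a ^ (Suc r * r div 2) * b ^ (r * (r - 1) div 2)"

definition theta_coeff :: "complex \<Rightarrow> complex \<Rightarrow> nat \<Rightarrow> complex" where
  "theta_coeff a b r = (if r = 0 then 1 else theta_half a b r + theta_half b a r)"

lemma theta_half_Suc: "theta_half a b (Suc r) = - (a * (a * b) ^ r * theta_half a b r)"
proof -
  have "Suc (Suc r) * Suc r div 2 = Suc r * r div 2 + r + 1"
    using triangular_Suc[of "Suc r"] by simp
  moreover have "Suc r * (Suc r - 1) div 2 = r * (r - 1) div 2 + r"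
    using triangular_Suc[of r] by simp
  ultimately show ?thesis
    unfolding theta_half_def by (simp only: power_add power_mult_distrib power_Suc) simp
qed

text \<open>Multiplied by (q;q)_(2N), this is the q-Pascal rule applied twice to [2N+2 choose N-s].
  The proof checks it as a rational identity in X = q^(N-s) and Y = q^(N+s+1).\<close>

lemma bailey_kernel_recurrence:
  fixes q :: complex
  assumes q: "norm q < 1" and s: "s \<le> N"
  shows "(1 - q ^ (2 * N + 1)) * (1 - q ^ (2 * N + 2)) * bailey_kernel q (Suc N) (Suc s)
    = (1 + q ^ (2 * N + 1)) * bailey_kernel q N (Suc s) + q ^ (N - s) * bailey_kernel q N s
      + q ^ (N + s + 2) * bailey_kernel q N (Suc (Suc s))"
proof -
  define E where "E = recip_qpoch q N s"
  define P where "P = qpoch q q (N + s + 2)"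
  define X where "X = q ^ (N - s)"
  define Y where "Y = q ^ (N + s + 1)"
  have XY: "q ^ (2 * N + 1) = X * Y"
    unfolding X_def Y_def power_add[symmetric] using s by (intro arg_cong[where f = "\<lambda>n. q ^ n"]) simp
  have XY': "q ^ (2 * N + 2) = q * X * Y" "q ^ (N + s + 2) = q * Y"
    using XY by (simp_all add: Y_def)
  have P: "P = qpoch q q (N + s) * ((1 - Y) * (1 - q * Y))" "P = qpoch q q (N + s + 1) * (1 - q * Y)"
    by (simp_all add: P_def Y_def qpoch_Suc)
  have nz: "P \<noteq> 0" "1 - Y \<noteq> 0" "1 - q * Y \<noteq> 0"
    using qpoch_nonzero[OF q] P unfolding P_def by (metis mult_eq_0_iff)+
  have R1: "recip_qpoch q N (Suc s) = (1 - X) * E"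
    using recip_qpoch_Suc_right[OF q s] by (simp add: X_def E_def)
  have u1: "bailey_kernel q (Suc N) (Suc s) = E / P"
    by (simp add: bailey_kernel_def recip_qpoch_def E_def P_def)
  have u0: "bailey_kernel q N s = E * ((1 - Y) * (1 - q * Y)) / P"
    using nz unfolding P(1) by (simp add: bailey_kernel_def E_def)
  have u2: "bailey_kernel q N (Suc s) = (1 - X) * E * (1 - q * Y) / P"
    using nz unfolding P(2) by (simp add: bailey_kernel_def R1)
  have u3: "q ^ (N + s + 2) * bailey_kernel q N (Suc (Suc s)) = (1 - X) * (q * Y - X * Y) * E / P"
  proof (cases "s = N")
    case True
    then show ?thesis by (simp add: X_def bailey_kernel_def recip_qpoch_def)
  next
    case False
    then have s': "Suc s \<le> N" using s by simp
    then have "q * q ^ (N - Suc s) = X" by (simp add: X_def Suc_diff_Suc flip: power_Suc)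
    then have "q * (1 - q ^ (N - Suc s)) = q - X" by (simp add: algebra_simps)
    moreover have "bailey_kernel q N (Suc (Suc s)) = (1 - q ^ (N - Suc s)) * ((1 - X) * E) / P"
      by (simp add: bailey_kernel_def recip_qpoch_Suc_right[OF q s'] R1 P_def)
    ultimately show ?thesis unfolding XY'
      by (simp add: field_simps)
  qed
  have "(1 - X * Y) * (1 - q * X * Y) = (1 + X * Y) * ((1 - X) * (1 - q * Y)) + X * ((1 - Y) * (1 - q * Y))
      + (1 - X) * (q * Y - X * Y)"
    by (simp add: algebra_simps)
  then show ?thesis
    unfolding u3 u0 u1 u2 XY XY'(1) X_def[symmetric]
    by (simp add: add_divide_distrib[symmetric] algebra_simps)
qed

text \<open>
  By the kernel recurrence and \<open>theta_half_Suc\<close>, each summand is a difference of consecutive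
  boundary terms.
\<close>
lemma finite_theta_partial_sum:
  fixes a b :: complex
  assumes Q: "Q = a * b" "norm Q < 1" and "R \<le> Suc N"
  shows "(\<Sum>r\<le>R. theta_coeff a b r * ((1 - Q ^ (2 * N + 1)) * (1 - Q ^ (2 * N + 2)) * bailey_kernel Q (Suc N) r
            - (1 - a * Q ^ N) * (1 - b * Q ^ N) * bailey_kernel Q N r))
         = Q ^ N * (a * theta_half a b R + b * theta_half b a R) * bailey_kernel Q N R
           + Q ^ (N + R + 1) * (theta_half a b R + theta_half b a R) * bailey_kernel Q N (Suc R)"
  using assms(3)
proof (induction R)
  case 0
  \<comment> \<open>The coefficient at 0 is 1 and not the sum of two halves, which would be 2, and
    the kernel recurrence starts at index 1. Hence this case is verified directly, in y = Q^N and z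
    = Q^(N+1).\<close>
  define z where "z = Q ^ Suc N"
  define y where "y = Q ^ N"
  define E where "E = recip_qpoch Q N 0"
  have z: "1 - z \<noteq> 0" unfolding z_def by (rule one_minus_power_nonzero[OF Q(2)]) simp
  have E: "E = 1 / qpoch Q Q N" by (simp add: E_def recip_qpoch_def)
  have u: "bailey_kernel Q N 0 = E * E" "bailey_kernel Q (Suc N) 0 = E * E / (1 - z)\<^sup>2"
    "bailey_kernel Q N (Suc 0) = (1 - y) * (E * E) / (1 - z)"
    using recip_qpoch_Suc_right[OF Q(2), of 0 N]
    by (simp_all add: bailey_kernel_def E recip_qpoch_def[of _ _ 0] z_def y_def qpoch_Suc power2_eq_square)
  have p: "Q ^ (2 * N + 1) = y * z" "Q ^ (2 * N + 2) = z * z" "a * b * y = z" "z = Q * y"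
    by (simp_all add: y_def z_def mult_2 power_add Q)
  have "(1 - a * y) * (1 - b * y) = 1 + y * (a * b * y) - (a + b) * y"
    by (simp add: algebra_simps)
  then have ab: "(1 - a * y) * (1 - b * y) = 1 + y * z - (a + b) * y"
    unfolding p(3) .
  have key: "(1 - y * z) * (1 - z * z) / (1 - z)\<^sup>2 = 1 + y * z + 2 * z * (1 - y) / (1 - z)"
  proof -
    have "(1 - y * z) * (1 - z * z) = (1 + y * z) * (1 - z)\<^sup>2 + 2 * z * (1 - y) * (1 - z)"
      by (simp add: algebra_simps power2_eq_square)
    then show ?thesis using z by (simp add: add_divide_distrib power2_eq_square)
  qed
  have "(1 - y * z) * (1 - z * z) * (E * E / (1 - z)\<^sup>2) - (1 - a * y) * (1 - b * y) * (E * E)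
      = ((1 - y * z) * (1 - z * z) / (1 - z)\<^sup>2 - (1 - a * y) * (1 - b * y)) * (E * E)"
    by (simp add: left_diff_distrib)
  also have "\<dots>
      = y * (a + b) * (E * E) + z * 2 * ((1 - y) * (E * E) / (1 - z))"
    unfolding key ab by (simp add: algebra_simps)
  finally show ?case
    unfolding p(1,2) by (simp add: theta_coeff_def theta_half_def u p(1,2) p(4)[symmetric] flip: y_def z_def)
next
  case (Suc s)
  define r where "r = Suc s"
  define w where "w = theta_half a b r"
  define w' where "w' = theta_half b a r"
  have s: "s \<le> N" using Suc.prems by simp
  have X: "Q ^ N = Q ^ (N - s) * Q ^ s" using s by (simp flip: power_add)
  have ws: "w = - (a * Q ^ s * theta_half a b s)" "w' = - (b * Q ^ s * theta_half b a s)"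
    unfolding w_def w'_def r_def theta_half_Suc Q by (simp_all add: mult.commute)
  \<comment> \<open>The boundary term at s is expressed through the halves at s + 1; in
    \<open>e2\<close> the extra factor Q = ab supplies the a or b that \<open>theta_half_Suc\<close>
    requires. The Q^(N-s) terms then cancel, and (a + b)(w + w') - (b w + a w') = a w + b w' gives
    the new boundary term.\<close>
  have e1: "Q ^ N * (a * theta_half a b s + b * theta_half b a s) = - (Q ^ (N - s)) * (w + w')"
    unfolding X ws by (simp add: algebra_simps)
  have "Q ^ (N + s + 1) = a * b * Q ^ s * Q ^ N" by (simp add: Q power_add mult_ac)
  then have e2: "Q ^ (N + s + 1) * (theta_half a b s + theta_half b a s) = - (Q ^ N) * (b * w + a * w')"
    unfolding ws by (simp add: algebra_simps)
  have "Q ^ (2 * N + 1) = a * b * Q ^ N * Q ^ N"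
    unfolding Q(1)[symmetric] by (simp add: mult_2 power_add)
  then have ab: "(1 - a * Q ^ N) * (1 - b * Q ^ N) = 1 + Q ^ (2 * N + 1) - (a + b) * Q ^ N"
    by (simp only:) (simp add: algebra_simps)
  have rec: "(1 - Q ^ (2 * N + 1)) * (1 - Q ^ (2 * N + 2)) * bailey_kernel Q (Suc N) r
    = (1 + Q ^ (2 * N + 1)) * bailey_kernel Q N r + Q ^ (N - s) * bailey_kernel Q N s
      + Q ^ (N + r + 1) * bailey_kernel Q N (Suc r)"
    using bailey_kernel_recurrence[OF Q(2) s] by (simp add: r_def)
  have c: "theta_coeff a b r = w + w'" by (simp add: theta_coeff_def w_def w'_def r_def)
  have "(\<Sum>r\<le>Suc s. theta_coeff a b r * ((1 - Q ^ (2 * N + 1)) * (1 - Q ^ (2 * N + 2)) * bailey_kernel Q (Suc N) r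
            - (1 - a * Q ^ N) * (1 - b * Q ^ N) * bailey_kernel Q N r))
     = - (Q ^ (N - s)) * (w + w') * bailey_kernel Q N s - Q ^ N * (b * w + a * w') * bailey_kernel Q N r
       + (w + w') * ((1 + Q ^ (2 * N + 1)) * bailey_kernel Q N r + Q ^ (N - s) * bailey_kernel Q N s
      + Q ^ (N + r + 1) * bailey_kernel Q N (Suc r) - (1 + Q ^ (2 * N + 1) - (a + b) * Q ^ N) * bailey_kernel Q N r)"
    unfolding sum.atMost_Suc Suc.IH[OF Suc_leD[OF Suc.prems]]
    unfolding e1 e2 r_def[symmetric] unfolding rec c ab by simp
  also have "\<dots> = Q ^ N * (a * w + b * w') * bailey_kernel Q N r
     + Q ^ (N + r + 1) * (w + w') * bailey_kernel Q N (Suc r)"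
    by (simp add: algebra_simps)
  finally show ?case by (simp only: r_def w_def w'_def)
qed

text \<open>At R = N + 1 the boundary term of \<open>finite_theta_partial_sum\<close> lies outside
  the support of the kernel, which leaves a first-order recurrence in N. Multiplied by (Q;Q)_(2N),
  the identity is a symmetric form of the finite q-binomial theorem.\<close>

theorem finite_jacobi_triple_product:
  fixes a b :: complex
  assumes Q: "Q = a * b" "norm Q < 1"
  shows "(\<Sum>r\<le>N. theta_coeff a b r * bailey_kernel Q N r) = qpoch a Q N * qpoch b Q N / qpoch Q Q (2 * N)"
proof (induction N)
  case 0
  then show ?case by (simp add: theta_coeff_def bailey_kernel_def recip_qpoch_def)
next
  case (Suc N)
  define S where "S M = (\<Sum>r\<le>M. theta_coeff a b r * bailey_kernel Q M r)" for M
  define u where "u = 1 - Q ^ (2 * N + 1)"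
  define v where "v = 1 - Q ^ (2 * N + 2)"
  have nz: "u \<noteq> 0" "v \<noteq> 0" unfolding u_def v_def by (rule one_minus_power_nonzero[OF Q(2)]; simp)+
  have "(\<Sum>r\<le>Suc N. theta_coeff a b r * (u * v * bailey_kernel Q (Suc N) r
            - (1 - a * Q ^ N) * (1 - b * Q ^ N) * bailey_kernel Q N r)) = 0"
    unfolding finite_theta_partial_sum[OF Q order_refl] u_def v_def
    by (simp add: bailey_kernel_def recip_qpoch_def)
  moreover have "(\<Sum>r\<le>Suc N. theta_coeff a b r * bailey_kernel Q N r) = S N"
    by (simp add: S_def bailey_kernel_def recip_qpoch_def)
  moreover have "(\<Sum>r\<le>Suc N. theta_coeff a b r * (u * v * bailey_kernel Q (Suc N) r
            - (1 - a * Q ^ N) * (1 - b * Q ^ N) * bailey_kernel Q N r))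
     = u * v * S (Suc N) - (1 - a * Q ^ N) * (1 - b * Q ^ N) * (\<Sum>r\<le>Suc N. theta_coeff a b r * bailey_kernel Q N r)"
    unfolding S_def sum_distrib_left sum_subtractf[symmetric] by (intro sum.cong) (auto simp: algebra_simps)
  ultimately have "u * v * S (Suc N) = (1 - a * Q ^ N) * (1 - b * Q ^ N) * S N" by simp
  then have "S (Suc N) = (1 - a * Q ^ N) * (1 - b * Q ^ N) * S N / (u * v)"
    using nz by (simp add: nonzero_eq_divide_eq mult.commute)
  moreover have "qpoch Q Q (2 * Suc N) = qpoch Q Q (2 * N) * (u * v)"
    by (simp add: u_def v_def qpoch_Suc)
  moreover have "S N = qpoch a Q N * qpoch b Q N / qpoch Q Q (2 * N)"
    using Suc by (simp add: S_def)
  ultimately have "S (Suc N) = qpoch a Q (Suc N) * qpoch b Q (Suc N) / qpoch Q Q (2 * Suc N)"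
    by (simp add: qpoch_Suc[of a] qpoch_Suc[of b] mult_ac)
  then show ?case by (simp only: S_def)
qed

text \<open>In the limit of the finite form the kernel yields (Q;Q)_inf^(-2) and the right side
  (Q;Q)_inf^(-1), so one factor (Q;Q)_inf moves over. The bounds on a and b dominate the theta terms
  by |a|^r + |b|^r.\<close>

theorem jacobi_triple_product:
  fixes a b :: complex
  assumes "norm a < 1" "norm b < 1"
  shows "(theta_coeff a b has_sum (qpoch_inf a (a * b) * qpoch_inf b (a * b) * qpoch_inf (a * b) (a * b))) UNIV"
proof -
  define Q where "Q = a * b"
  have Q: "norm Q < 1"
    using mult_strict_mono'[OF assms] by (simp add: Q_def norm_mult)
  have half: "norm (theta_half a b r) \<le> norm a ^ r" if "norm a < 1" "norm b < 1" for a b r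
  proof -
    have "r \<le> Suc r * r div 2" by (induction r) auto
    then have "norm a ^ (Suc r * r div 2) * norm b ^ (r * (r - 1) div 2) \<le> norm a ^ r * 1"
      using that by (intro mult_mono power_decreasing power_le_one) auto
    then show ?thesis by (simp add: theta_half_def norm_mult norm_power)
  qed
  have sc: "summable (\<lambda>r. norm (theta_coeff a b r))"
  proof (rule summable_comparison_test')
    show "summable (\<lambda>r. norm a ^ r + norm b ^ r)"
      using assms by (intro summable_add summable_geometric) auto
    show "norm (norm (theta_coeff a b r)) \<le> norm a ^ r + norm b ^ r" if "r \<ge> 0" for r
      using norm_triangle_mono[OF half[OF assms] half[OF assms(2,1)]] by (auto simp: theta_coeff_def)
  qed
  obtain C where C: "\<And>n r. norm (bailey_kernel Q n r) \<le> C"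
    using recip_qpoch_bounded[OF Q] by metis
  have "(\<lambda>n. \<Sum>r\<le>n. theta_coeff a b r * bailey_kernel Q n r) \<longlonglongrightarrow> suminf (theta_coeff a b) * (1 / (qpoch_inf Q Q)\<^sup>2)"
    by (rule triangular_sum_LIMSEQ[where g = "bailey_kernel Q", OF sc bailey_kernel_LIMSEQ[OF Q] C]) (simp add: bailey_kernel_def recip_qpoch_def)
  moreover have "(\<lambda>n. qpoch a Q n * qpoch b Q n / qpoch Q Q (2 * n)) \<longlonglongrightarrow> qpoch_inf a Q * qpoch_inf b Q / qpoch_inf Q Q"
  proof (intro tendsto_divide tendsto_mult qpoch_LIMSEQ Q qpoch_inf_nonzero)
    have "strict_mono (\<lambda>n::nat. 2 * n)" by (simp add: strict_mono_def)
    from LIMSEQ_subseq_LIMSEQ[OF qpoch_LIMSEQ[OF Q] this]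
    show "(\<lambda>n. qpoch Q Q (2 * n)) \<longlonglongrightarrow> qpoch_inf Q Q" by (simp add: o_def)
  qed
  ultimately have "suminf (theta_coeff a b) * (1 / (qpoch_inf Q Q)\<^sup>2) = qpoch_inf a Q * qpoch_inf b Q / qpoch_inf Q Q"
    unfolding finite_jacobi_triple_product[OF Q_def Q] by (rule LIMSEQ_unique)
  then have "suminf (theta_coeff a b) = qpoch_inf a Q * qpoch_inf b Q * qpoch_inf Q Q"
    using qpoch_inf_nonzero[OF Q] by (simp add: field_simps power2_eq_square)
  moreover have "theta_coeff a b sums suminf (theta_coeff a b)"
    by (rule summable_sums[OF summable_norm_cancel[OF sc]])
  ultimately show ?thesis using norm_summable_imp_has_sum[OF sc] by (simp add: Q_def)
qed

subsection \<open>Sums over chains\<close>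

text \<open>Absolute summability is a second conclusion so that the rule can be iterated to three
  factors.\<close>

lemma has_sum_times:
  fixes f :: "'a \<Rightarrow> complex" and g :: "'b \<Rightarrow> complex"
  assumes f: "(f has_sum S) A" "(\<lambda>x. norm (f x)) summable_on A"
    and g: "(g has_sum T) B" "(\<lambda>y. norm (g y)) summable_on B"
  shows "((\<lambda>(x, y). f x * g y) has_sum (S * T)) (A \<times> B)"
    and "(\<lambda>(x, y). norm (f x * g y)) summable_on (A \<times> B)"
proof -
  have abs: "(\<lambda>z. norm (f (fst z) * g (snd z))) summable_on (A \<times> B)"
  proof (rule summable_on_SigmaI)
    show "((\<lambda>y. norm (f (fst (x, y)) * g (snd (x, y)))) has_sum (norm (f x) * infsum (\<lambda>y. norm (g y)) B)) B" for x
      using has_sum_cmult_right[OF has_sum_infsum[OF g(2)]] by (simp add: norm_mult)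
    show "(\<lambda>x. norm (f x) * infsum (\<lambda>y. norm (g y)) B) summable_on A"
      by (rule summable_on_cmult_left[OF f(2)])
  qed simp
  then show "(\<lambda>(x, y). norm (f x * g y)) summable_on (A \<times> B)"
    by (simp add: case_prod_unfold)
  have "((\<lambda>z. f (fst z) * g (snd z)) has_sum (S * T)) (A \<times> B)"
  proof (rule has_sum_SigmaI)
    show "((\<lambda>y. f (fst (x, y)) * g (snd (x, y))) has_sum (f x * T)) B" for x
      using has_sum_cmult_right[OF g(1)] by simp
    show "((\<lambda>x. f x * T) has_sum S * T) A" by (rule has_sum_cmult_left[OF f(1)])
  qed (rule abs_summable_summable[OF abs])
  then show "((\<lambda>(x, y). f x * g y) has_sum (S * T)) (A \<times> B)"
    by (simp add: case_prod_unfold)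
qed

text \<open>The factor 1/(q;q)_(n_1) is left out on purpose: it belongs to the coupling factor,
  where \<open>dixon_sum\<close> needs it.\<close>

definition chain_weight :: "nat \<Rightarrow> complex \<Rightarrow> (nat \<Rightarrow> nat) \<Rightarrow> complex" where
  "chain_weight k q n = q ^ (\<Sum>i=1..k. (n i)\<^sup>2) / (\<Prod>i=2..k. qpoch q q (n i - n (i - 1)))"

lemma summand_chain_weight:
  "summand k q n l = chain_weight k q n * chain_weight k q l *
     (q ^ (n 1 * l 1) / (qpoch q q (n 1 + l 1) * qpoch q q (n 1) * qpoch q q (l 1)))"
  by (simp add: summand_def chain_weight_def power_add)

definition cons_chain :: "nat \<Rightarrow> nat \<Rightarrow> (nat \<Rightarrow> nat) \<Rightarrow> nat \<Rightarrow> nat" where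
  "cons_chain k m c = restrict (\<lambda>i. if i = 1 then m else c (i - 1)) {1..Suc k}"

definition tl_chain :: "nat \<Rightarrow> (nat \<Rightarrow> nat) \<Rightarrow> nat \<Rightarrow> nat" where
  "tl_chain k n = restrict (\<lambda>i. n (Suc i)) {1..k}"

lemma weak_chainsD:
  assumes "n \<in> weak_chains k" "1 \<le> i" "i \<le> j" "j \<le> k"
  shows "n i \<le> n j"
  using assms by (auto simp: weak_chains_def mono_on_def)

lemma cons_chain_weak_chains:
  assumes "k \<ge> 1" "c \<in> weak_chains k" "m \<le> c 1"
  shows "cons_chain k m c \<in> weak_chains (Suc k)"
proof -
  have "cons_chain k m c i \<le> cons_chain k m c j" if "1 \<le> i" "i \<le> j" "j \<le> Suc k" for i j
  proof (cases "i = 1")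
    case True
    show ?thesis
    proof (cases "j = 1")
      case False
      then have "c 1 \<le> c (j - 1)" using that by (intro weak_chainsD[OF assms(2)]) auto
      then show ?thesis using True False that assms(3) by (simp add: cons_chain_def)
    qed (use True in simp)
  next
    case False
    then have "c (i - 1) \<le> c (j - 1)" using that by (intro weak_chainsD[OF assms(2)]) auto
    then show ?thesis using False that by (simp add: cons_chain_def)
  qed
  then show ?thesis by (auto simp: weak_chains_def mono_on_def cons_chain_def)
qed

lemma cons_chain_1 [simp]: "cons_chain k m c (Suc 0) = m"
  by (simp add: cons_chain_def)

lemma tl_chain_weak_chains:
  assumes "n \<in> weak_chains (Suc k)"
  shows "tl_chain k n \<in> weak_chains k"
proof -
  have "tl_chain k n i \<le> tl_chain k n j" if "1 \<le> i" "i \<le> j" "j \<le> k" for i j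
    using that weak_chainsD[OF assms, of "Suc i" "Suc j"] by (simp add: tl_chain_def)
  then show ?thesis by (auto simp: weak_chains_def mono_on_def tl_chain_def)
qed

lemma cons_tl_chain:
  assumes "n \<in> weak_chains (Suc k)"
  shows "cons_chain k (n 1) (tl_chain k n) = n"
proof
  fix i
  show "cons_chain k (n 1) (tl_chain k n) i = n i"
  proof (cases "i \<in> {1..Suc k}")
    case True
    then show ?thesis by (auto simp: cons_chain_def tl_chain_def)
  next
    case False
    then have "n i = undefined" using assms PiE_arb unfolding weak_chains_def by blast
    then show ?thesis using False unfolding cons_chain_def by (simp only: restrict_apply if_False)
  qed
qed

lemma tl_cons_chain:
  assumes "c \<in> weak_chains k"
  shows "tl_chain k (cons_chain k m c) = c"
proof
  fix i
  show "tl_chain k (cons_chain k m c) i = c i"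
  proof (cases "i \<in> {1..k}")
    case True
    then show ?thesis by (auto simp: cons_chain_def tl_chain_def)
  next
    case False
    then have "c i = undefined" using assms PiE_arb unfolding weak_chains_def by blast
    then show ?thesis using False unfolding tl_chain_def by (simp only: restrict_apply if_False)
  qed
qed

lemma chain_weight_cons_chain:
  assumes "k \<ge> 1"
  shows "chain_weight (Suc k) q (cons_chain k m c) = q ^ (m\<^sup>2) / qpoch q q (c 1 - m) * chain_weight k q c"
proof -
  have s: "(\<Sum>i=1..Suc k. (cons_chain k m c i)\<^sup>2) = m\<^sup>2 + (\<Sum>i=1..k. (c i)\<^sup>2)"
  proof -
    have "(\<Sum>i=1..Suc k. (cons_chain k m c i)\<^sup>2)
        = (cons_chain k m c 1)\<^sup>2 + (\<Sum>i=Suc 1..Suc k. (cons_chain k m c i)\<^sup>2)"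
      by (rule sum.atLeast_Suc_atMost) simp
    also have "(\<Sum>i=Suc 1..Suc k. (cons_chain k m c i)\<^sup>2) = (\<Sum>i=1..k. (c i)\<^sup>2)"
      unfolding sum.shift_bounds_cl_Suc_ivl by (rule sum.cong) (auto simp: cons_chain_def)
    finally show ?thesis by (simp add: cons_chain_def)
  qed
  have p: "(\<Prod>i=2..Suc k. qpoch q q (cons_chain k m c i - cons_chain k m c (i - 1)))
     = qpoch q q (c 1 - m) * (\<Prod>i=2..k. qpoch q q (c i - c (i - 1)))"
  proof -
    have "(\<Prod>i=2..Suc k. qpoch q q (cons_chain k m c i - cons_chain k m c (i - 1)))
      = (\<Prod>i=1..k. qpoch q q (cons_chain k m c (Suc i) - cons_chain k m c i))"
      using prod.shift_bounds_cl_Suc_ivl[of "\<lambda>i. qpoch q q (cons_chain k m c i - cons_chain k m c (i - 1))" 1 k]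
      by (simp add: numeral_2_eq_2)
    also have "\<dots> = qpoch q q (cons_chain k m c (Suc 1) - cons_chain k m c 1)
        * (\<Prod>i=Suc 1..k. qpoch q q (cons_chain k m c (Suc i) - cons_chain k m c i))"
      by (rule prod.atLeast_Suc_atMost[OF assms])
    also have "(\<Prod>i=Suc 1..k. qpoch q q (cons_chain k m c (Suc i) - cons_chain k m c i))
        = (\<Prod>i=2..k. qpoch q q (c i - c (i - 1)))"
      by (rule prod.cong) (auto simp: cons_chain_def)
    finally show ?thesis using assms by (simp add: cons_chain_def)
  qed
  show ?thesis unfolding chain_weight_def s p by (simp add: power_add)
qed

text \<open>Chains are peeled at their smallest entry, because that is the entry on which the kernel
  depends. The fibre over c is then the finite set of m <= c_1, the range of
  \<open>bailey_step\<close>.\<close>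

lemma has_sum_weak_chains_Suc:
  assumes "k \<ge> 1"
  shows "(f has_sum S) (weak_chains (Suc k))
    \<longleftrightarrow> ((\<lambda>(c, m). f (cons_chain k m c)) has_sum S) (SIGMA c:weak_chains k. {..c 1})"
proof (rule sym, rule has_sum_reindex_bij_witness[where i = "\<lambda>n. (tl_chain k n, n 1)" and j = "\<lambda>(c, m). cons_chain k m c"])
  fix n assume n: "n \<in> weak_chains (Suc k)"
  have "n 1 \<le> n 2" using weak_chainsD[OF n, of 1 2] assms by simp
  then show "(tl_chain k n, n 1) \<in> (SIGMA c:weak_chains k. {..c 1})"
    using tl_chain_weak_chains[OF n] assms by (auto simp: tl_chain_def numeral_2_eq_2)
  show "(case (tl_chain k n, n 1) of (c, m) \<Rightarrow> cons_chain k m c) = n"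
    using cons_tl_chain[OF n] by simp
next
  fix z assume "z \<in> (SIGMA c:weak_chains k. {..c 1})"
  then obtain c m where z: "z = (c, m)" "c \<in> weak_chains k" "m \<le> c 1" by auto
  show "(case z of (c, m) \<Rightarrow> cons_chain k m c) \<in> weak_chains (Suc k)"
    using z cons_chain_weak_chains[OF assms] by simp
  show "(tl_chain k (case z of (c, m) \<Rightarrow> cons_chain k m c), (case z of (c, m) \<Rightarrow> cons_chain k m c) 1) = z"
    using z tl_cons_chain by simp
  show "f (case z of (c, m) \<Rightarrow> cons_chain k m c) = (case z of (c, m) \<Rightarrow> f (cons_chain k m c))"
    by (simp add: z)
qed simp

lemma has_sum_weak_chains_1:
  "(f has_sum S) (weak_chains 1) \<longleftrightarrow> ((\<lambda>m. f (restrict (\<lambda>_. m) {1})) has_sum S) UNIV"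
proof (rule sym, rule has_sum_reindex_bij_witness[where i = "\<lambda>n. n 1" and j = "\<lambda>m. restrict (\<lambda>_. m) {1}"])
  fix n :: "nat \<Rightarrow> nat" assume "n \<in> weak_chains 1"
  then have "n \<in> extensional {1}" by (simp add: weak_chains_def PiE_def)
  then show "restrict (\<lambda>_. n 1) {1} = n"
    by (intro ext) (auto simp: extensional_def restrict_def)
qed (auto simp: weak_chains_def mono_on_def)

text \<open>Prepending a smallest entry costs at most a factor D C independent of the rest of the
  chain: C bounds the new denominator and D is the sum of |q|^(m^2).\<close>

lemma chain_weight_abs_summable:
  fixes q :: complex
  assumes q: "norm q < 1" and "k \<ge> 1"
  shows "(\<lambda>n. norm (chain_weight k q n)) summable_on (weak_chains k)"
  using assms(2)
proof (induction k rule: nat_induct_at_least)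
  case base
  have "(\<lambda>m. norm (q ^ (m\<^sup>2))) summable_on UNIV"
    using q by (intro norm_summable_imp_summable_on) (simp add: norm_power summable_power_square)
  then show ?case
    unfolding summable_on_def has_sum_weak_chains_1 by (simp add: chain_weight_def)
next
  case (Suc k)
  obtain C where C: "C > 0" "\<And>n. norm (1 / qpoch q q n) \<le> C"
    using recip_qpoch_bounded[OF q] by metis
  define D where "D = (\<Sum>m. norm q ^ (m\<^sup>2))"
  have "(\<lambda>z. norm (chain_weight (Suc k) q (cons_chain k (snd z) (fst z)))) summable_on (SIGMA c:weak_chains k. {..c 1})"
  proof (rule summable_on_SigmaI)
    fix c :: "nat \<Rightarrow> nat"
    show "((\<lambda>m. norm (chain_weight (Suc k) q (cons_chain k (snd (c, m)) (fst (c, m))))) has_sum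
       (\<Sum>m\<le>c 1. norm (chain_weight (Suc k) q (cons_chain k m c)))) {..c 1}"
      by (intro has_sum_finiteI) auto
  next
    have "(\<lambda>c. norm (\<Sum>m\<le>c 1. norm (chain_weight (Suc k) q (cons_chain k m c)))) summable_on weak_chains k"
    proof (rule Infinite_Sum.abs_summable_on_comparison_test')
      show "(\<lambda>c. D * C * norm (chain_weight k q c)) summable_on weak_chains k"
        by (rule summable_on_cmult_right[OF Suc.IH])
      fix c :: "nat \<Rightarrow> nat"
      have "(\<Sum>m\<le>c 1. norm (chain_weight (Suc k) q (cons_chain k m c)))
          \<le> (\<Sum>m\<le>c 1. norm q ^ (m\<^sup>2) * (C * norm (chain_weight k q c)))"
      proof (rule sum_mono)
        fix m
        have "norm (chain_weight (Suc k) q (cons_chain k m c))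
          = norm q ^ (m\<^sup>2) * (norm (1 / qpoch q q (c 1 - m)) * norm (chain_weight k q c))"
          by (simp add: chain_weight_cons_chain[OF Suc.hyps] norm_mult norm_divide norm_power)
        also have "\<dots> \<le> norm q ^ (m\<^sup>2) * (C * norm (chain_weight k q c))"
          by (intro mult_left_mono mult_right_mono C) auto
        finally show "norm (chain_weight (Suc k) q (cons_chain k m c)) \<le> norm q ^ (m\<^sup>2) * (C * norm (chain_weight k q c))" .
      qed
      also have "\<dots> = (\<Sum>m\<le>c 1. norm q ^ (m\<^sup>2)) * (C * norm (chain_weight k q c))"
        by (simp add: sum_distrib_right)
      also have "\<dots> \<le> D * (C * norm (chain_weight k q c))"
        unfolding D_def using q C(1)
        by (intro mult_right_mono sum_le_suminf summable_power_square) auto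
      finally show "norm (\<Sum>m\<le>c 1. norm (chain_weight (Suc k) q (cons_chain k m c))) \<le> D * C * norm (chain_weight k q c)"
        by (simp add: sum_nonneg mult.assoc)
    qed
    then show "(\<lambda>c. \<Sum>m\<le>c 1. norm (chain_weight (Suc k) q (cons_chain k m c))) summable_on weak_chains k"
      by (simp add: sum_nonneg)
  qed simp
  then show ?case
    unfolding summable_on_def has_sum_weak_chains_Suc[OF Suc.hyps] by (simp add: case_prod_unfold)
qed

lemma chain_weight_kernel_abs_summable:
  fixes q :: complex
  assumes q: "norm q < 1" and k: "k \<ge> 1"
  shows "(\<lambda>n. norm (chain_weight k q n * bailey_kernel q (n 1) r)) summable_on (weak_chains k)"
proof -
  obtain C where C: "\<And>n r. norm (bailey_kernel q n r) \<le> C"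
    using recip_qpoch_bounded[OF q] by metis
  show ?thesis
  proof (rule Infinite_Sum.abs_summable_on_comparison_test')
    show "(\<lambda>n. norm (chain_weight k q n) * C) summable_on weak_chains k"
      by (rule summable_on_cmult_left[OF chain_weight_abs_summable[OF q k]])
  qed (simp add: norm_mult mult_left_mono C)
qed

text \<open>Summing over the smallest entry moves the kernel to the next entry and yields q^(r^2),
  by \<open>bailey_step\<close>. After k - 1 such moves only the unbounded entry is left, which is
  \<open>bailey_limit\<close>.\<close>

lemma bailey_chain:
  fixes q :: complex
  assumes q: "norm q < 1" and "k \<ge> 1"
  shows "((\<lambda>n. chain_weight k q n * bailey_kernel q (n 1) r) has_sum (q ^ (k * r\<^sup>2) / qpoch_inf q q)) (weak_chains k)"
  using assms(2)
proof (induction k rule: nat_induct_at_least)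
  case base
  show ?case unfolding has_sum_weak_chains_1 using bailey_limit[OF q, of r] by (simp add: chain_weight_def)
next
  case (Suc k)
  define g where "g z = chain_weight (Suc k) q (cons_chain k (snd z) (fst z)) * bailey_kernel q (snd z) r"
    for z :: "(nat \<Rightarrow> nat) \<times> nat"
  have g: "(\<lambda>(c, m). chain_weight (Suc k) q (cons_chain k m c) * bailey_kernel q (cons_chain k m c 1) r) = g"
    by (auto simp: g_def fun_eq_iff)
  have "(g has_sum (q ^ (r\<^sup>2) * (q ^ (k * r\<^sup>2) / qpoch_inf q q))) (SIGMA c:weak_chains k. {..c 1})"
  proof (rule has_sum_SigmaI)
    fix c :: "nat \<Rightarrow> nat"
    have "(\<Sum>m\<le>c 1. g (c, m))
      = chain_weight k q c * (\<Sum>m\<le>c 1. q ^ (m\<^sup>2) * bailey_kernel q m r / qpoch q q (c 1 - m))"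
      unfolding sum_distrib_left by (intro sum.cong) (auto simp: g_def chain_weight_cons_chain[OF Suc.hyps])
    then show "((\<lambda>m. g (c, m)) has_sum (q ^ (r\<^sup>2) * (chain_weight k q c * bailey_kernel q (c 1) r))) {..c 1}"
      unfolding bailey_step[OF q] by (intro has_sum_finiteI) auto
  next
    show "((\<lambda>c. q ^ r\<^sup>2 * (chain_weight k q c * bailey_kernel q (c 1) r)) has_sum
      (q ^ (r\<^sup>2) * (q ^ (k * r\<^sup>2) / qpoch_inf q q))) (weak_chains k)"
      by (rule has_sum_cmult_right[OF Suc.IH])
  next
    have "(\<lambda>n. chain_weight (Suc k) q n * bailey_kernel q (n 1) r) summable_on weak_chains (Suc k)"
      by (rule abs_summable_summable[OF chain_weight_kernel_abs_summable[OF q]]) simp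
    then show "g summable_on (SIGMA c:weak_chains k. {..c 1})"
      unfolding summable_on_def has_sum_weak_chains_Suc[OF Suc.hyps] g .
  qed
  then show ?case
    unfolding has_sum_weak_chains_Suc[OF Suc.hyps] g by (simp add: power_add)
qed

lemma dixon_coeff_abs_summable:
  assumes q: "norm q < 1"
  shows "summable (\<lambda>r. norm (dixon_coeff q r))"
proof (rule summable_comparison_test')
  show "summable (\<lambda>r. norm q ^ r * 2)" using q by (intro summable_mult2 summable_geometric) auto
  \<comment> \<open>From r = 3 on, r(r-1)/2 >= r, which permits a geometric majorant.\<close>
  fix r :: nat assume r: "r \<ge> 3"
  then have "r * 2 \<le> r * (r - 1)" by (intro mult_le_mono) auto
  then have "r \<le> r * (r - 1) div 2" using div_le_mono[of "r * 2" "r * (r - 1)" 2] by simp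
  then have "norm q ^ (r * (r - 1) div 2) \<le> norm q ^ r" using q by (intro power_decreasing) auto
  moreover have "norm (1 + q ^ r) \<le> 2"
    using norm_triangle_ineq[of 1 "q ^ r"] power_le_one[of "norm q" r] q by (simp add: norm_power)
  ultimately have "norm q ^ (r * (r - 1) div 2) * norm (1 + q ^ r) \<le> norm q ^ r * 2"
    by (intro mult_mono) auto
  then show "norm (norm (dixon_coeff q r)) \<le> norm q ^ r * 2"
    using r by (simp add: dixon_coeff_def norm_mult norm_power)
qed

text \<open>The square comes from the two chains. With t = r(r-1)/2 one has r^2 = 2t + r, so 2k r^2
  + t = 2k(t + r) + (2k+1)t and 2k r^2 + t + r = 2k t + (2k+1)(t + r). The coefficients 2k and 2k+1
  add up to the modulus 4k+1.\<close>

lemma dixon_coeff_theta_coeff: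
  "dixon_coeff q r * (q ^ (k * r\<^sup>2))\<^sup>2 = theta_coeff (q ^ (2 * k)) (q ^ (2 * k + 1)) r"
proof (cases "r = 0")
  case False
  define t where "t = r * (r - 1) div 2"
  have t: "Suc r * r div 2 = t + r" by (simp only: t_def triangular_Suc)
  have "2 * t = r * (r - 1)" unfolding t_def by (intro dvd_mult_div_cancel) (cases r; simp)
  then have r: "r\<^sup>2 = 2 * t + r" using False by (simp add: power2_eq_square algebra_simps)
  have e: "2 * k * (t + r) + (2 * k + 1) * t = t + k * r\<^sup>2 * 2"
    "(2 * k) * t + (2 * k + 1) * (t + r) = t + r + k * r\<^sup>2 * 2"
    unfolding r by (simp_all add: algebra_simps)
  have "theta_coeff (q ^ (2 * k)) (q ^ (2 * k + 1)) r
     = (-1) ^ r * (q ^ (2 * k * (t + r) + (2 * k + 1) * t) + q ^ ((2 * k) * t + (2 * k + 1) * (t + r)))"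
    using False unfolding theta_coeff_def theta_half_def t t_def[symmetric] power_mult[symmetric]
    by (simp only: if_False power_add distrib_left distrib_right mult_ac)
  also have "\<dots> = (-1) ^ r * q ^ t * (1 + q ^ r) * (q ^ (k * r\<^sup>2))\<^sup>2"
    unfolding e power_mult[symmetric] by (simp add: power_add algebra_simps)
  finally show ?thesis using False by (simp add: dixon_coeff_def t_def)
qed (simp add: dixon_coeff_def theta_coeff_def)

subsection \<open>The product side\<close>

text \<open>A block runs over 1..4k+1 rather than 0..4k, so that its multiple of the modulus
  supplies the factor 1 - Q Q^J of (Q;Q)_inf. The residue -2k appears as 2k+1.\<close>

lemma admissible_block:
  assumes "k \<ge> 1" "1 \<le> i" "i \<le> 4 * k + 1"
  shows "admissible k ((4 * k + 1) * J + i) \<longleftrightarrow> i \<notin> {2 * k, 2 * k + 1, 4 * k + 1}"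
proof -
  define K :: int where "K = 4 * int k + 1"
  have K: "K > 0" by (simp add: K_def)
  have m: "int ((4 * k + 1) * J + i) mod K = int i mod K"
  proof -
    have "int ((4 * k + 1) * J + i) = int i + K * int J" by (simp add: K_def algebra_simps)
    then show ?thesis by simp
  qed
  have neg: "(- 2 * int k) mod K = 2 * int k + 1"
  proof -
    have "- 2 * int k = (2 * int k + 1) + K * (-1)" by (simp add: K_def)
    then have "(- 2 * int k) mod K = (2 * int k + 1) mod K" by (metis mod_mult_self2)
    then show ?thesis using assms by (simp add: K_def)
  qed
  show ?thesis
  proof (cases "i = 4 * k + 1")
    case True
    then have "int i mod K = 0" by (simp add: K_def add.commute)
    then show ?thesis unfolding admissible_def cong_def K_def[symmetric] m using True by simp
  next
    case False
    then have "int i mod K = int i" using assms by (simp add: K_def)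
    moreover have "2 * int k mod K = 2 * int k" by (simp add: K_def)
    ultimately show ?thesis
      unfolding admissible_def cong_def K_def[symmetric] m neg using False assms by auto
  qed
qed

text \<open>Multiplication by (q;q)_inf cancels the admissible factors and leaves those with m = 0,
  2k or -2k modulo 4k+1. The limits are compared along n = K J, where the partial products consist
  of complete blocks.\<close>

lemma product_side_triple_product:
  fixes q :: complex
  assumes q: "norm q < 1" and k: "k \<ge> 1"
  defines "Q \<equiv> q ^ (4 * k + 1)"
  shows "product_side k q * qpoch_inf q q
    = qpoch_inf (q ^ (2 * k)) Q * qpoch_inf (q ^ (2 * k + 1)) Q * qpoch_inf Q Q"
proof -
  define K where "K = 4 * k + 1"
  define P where "P n = (\<Prod>m<n. if admissible k m then 1 / (1 - q ^ m) else 1)" for n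
  \<comment> \<open>Index 0 is not admissible, yet it must contribute 1, since 1 - q^0 would
    annihilate the product.\<close>
  define h where "h m = (if m = 0 \<or> admissible k m then 1 else 1 - q ^ m)" for m
  have Q: "norm Q < 1" unfolding Q_def by (rule norm_power_less_one[OF q]) simp
  have P: "P \<longlonglongrightarrow> product_side k q"
    using has_prod_imp_tendsto'[OF convergent_prod_has_prod[OF convergent_product_side[OF q, of k]]]
    by (simp add: P_def[abs_def] product_side_def)
  \<comment> \<open>The shift by one aligns the factors: \<open>P (Suc n)\<close> covers m = 0..n
    with a trivial factor at 0, and \<open>qpoch q q n\<close> covers q^1, ..., q^n.\<close>
  have Ph: "P (Suc n) * qpoch q q n = (\<Prod>m<Suc n. h m)" for n
  proof (induction n)
    case 0
    then show ?case by (simp add: P_def h_def admissible_def)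
  next
    case (Suc n)
    have "P (Suc (Suc n)) * qpoch q q (Suc n)
      = (P (Suc n) * qpoch q q n) * ((if admissible k (Suc n) then 1 / (1 - q ^ Suc n) else 1) * (1 - q ^ Suc n))"
      by (simp add: P_def qpoch_Suc)
    also have "(if admissible k (Suc n) then 1 / (1 - q ^ Suc n) else 1) * (1 - q ^ Suc n) = h (Suc n)"
      using one_minus_power_nonzero[OF q, of "Suc n"] by (simp add: h_def)
    finally show ?case unfolding Suc by simp
  qed
  have block: "(\<Prod>m<K * J + 1. h m) = qpoch (q ^ (2 * k)) Q J * qpoch (q ^ (2 * k + 1)) Q J * qpoch Q Q J" for J
  proof (induction J)
    case 0
    then show ?case by (simp add: h_def)
  next
    case (Suc J)
    have "(\<Prod>m<K * Suc J + 1. h m) = (\<Prod>m<K * J + 1. h m) * (\<Prod>m\<in>{K * J + 1..<K * Suc J + 1}. h m)"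
      unfolding lessThan_atLeast0 by (rule prod.atLeastLessThan_concat[symmetric]) auto
    also have "(\<Prod>m\<in>{K * J + 1..<K * Suc J + 1}. h m) = (\<Prod>i\<in>{1..K}. h (K * J + i))"
      by (rule prod.reindex_bij_witness[of _ "\<lambda>i. K * J + i" "\<lambda>m. m - K * J"]) auto
    also have "\<dots> = (\<Prod>i\<in>{2 * k, 2 * k + 1, 4 * k + 1}. h (K * J + i))"
    proof (rule prod.mono_neutral_right)
      show "\<forall>i\<in>{1..K} - {2 * k, 2 * k + 1, 4 * k + 1}. h (K * J + i) = 1"
        using admissible_block[OF k] by (auto simp: h_def K_def)
    qed (use k in \<open>auto simp: K_def\<close>)
    also have "\<dots> = (\<Prod>i\<in>{2 * k, 2 * k + 1, 4 * k + 1}. 1 - q ^ i * Q ^ J)"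
    proof (rule prod.cong[OF refl])
      fix i assume i: "i \<in> {2 * k, 2 * k + 1, 4 * k + 1}"
      then have "1 \<le> i" "i \<le> 4 * k + 1" using k by auto
      then have "h (K * J + i) = 1 - q ^ (K * J + i)"
        using admissible_block[OF k, of i J] i unfolding h_def K_def by auto
      then show "h (K * J + i) = 1 - q ^ i * Q ^ J"
        unfolding Q_def K_def[symmetric] power_mult[symmetric] by (simp add: power_add)
    qed
    also have "\<dots> = (1 - q ^ (2 * k) * Q ^ J) * (1 - q ^ (2 * k + 1) * Q ^ J) * (1 - Q * Q ^ J)"
      using k by (simp add: Q_def)
    finally show ?case unfolding Suc by (simp add: qpoch_Suc mult_ac)
  qed
  have "K > 0" by (simp add: K_def)
  then have "strict_mono (\<lambda>J. K * J)" by (simp add: strict_mono_def)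
  moreover have "(\<lambda>n. P (Suc n) * qpoch q q n) \<longlonglongrightarrow> product_side k q * qpoch_inf q q"
    by (intro tendsto_mult LIMSEQ_Suc P qpoch_LIMSEQ q)
  ultimately have "(\<lambda>J. P (Suc (K * J)) * qpoch q q (K * J)) \<longlonglongrightarrow> product_side k q * qpoch_inf q q"
    using LIMSEQ_subseq_LIMSEQ[of "\<lambda>n. P (Suc n) * qpoch q q n"] by (fastforce simp: o_def)
  moreover have "P (Suc (K * J)) * qpoch q q (K * J)
    = qpoch (q ^ (2 * k)) Q J * qpoch (q ^ (2 * k + 1)) Q J * qpoch Q Q J" for J
    using Ph[of "K * J"] block[of J] by simp
  moreover have "(\<lambda>J. qpoch (q ^ (2 * k)) Q J * qpoch (q ^ (2 * k + 1)) Q J * qpoch Q Q J)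
    \<longlonglongrightarrow> qpoch_inf (q ^ (2 * k)) Q * qpoch_inf (q ^ (2 * k + 1)) Q * qpoch_inf Q Q"
    by (intro tendsto_mult qpoch_LIMSEQ Q)
  ultimately show ?thesis by (simp only:) (rule LIMSEQ_unique)
qed

section \<open>Assembly: one triple sum over r and two chains, evaluated in both orders\<close>

theorem mainTheorem17:
  fixes k :: nat and q :: complex
  assumes "k \<ge> 1" and "norm q < 1"
  shows "((\<lambda>(n, l). summand k q n l) has_sum (1 / qpoch_inf q q * product_side k q))
           (weak_chains k \<times> weak_chains k)"
proof -
  note k = assms(1) and q = assms(2)
  define X where "X = weak_chains k"
  define w where "w r n = chain_weight k q n * bailey_kernel q (n 1) r" for r n
  define f where "f z = dixon_coeff q (fst z) * (w (fst z) (fst (snd z)) * w (fst z) (snd (snd z)))"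
    for z :: "nat \<times> (nat \<Rightarrow> nat) \<times> (nat \<Rightarrow> nat)"
  obtain C where C: "\<And>n r. norm (bailey_kernel q n r) \<le> C"
    using recip_qpoch_bounded[OF q] by metis
  have C0: "C \<ge> 0" using order_trans[OF norm_ge_zero C] .
  have wX: "(w r has_sum (q ^ (k * r\<^sup>2) / qpoch_inf q q)) X" "(\<lambda>n. norm (w r n)) summable_on X" for r
    using bailey_chain[OF q k] chain_weight_kernel_abs_summable[OF q k] by (simp_all add: w_def[abs_def] X_def)

  \<comment> \<open>Both kernels are bounded by C, so the majorant is C^2 times a product of three
    separately summable families.\<close>
  have abs_f: "(\<lambda>z. norm (f z)) summable_on (UNIV \<times> (X \<times> X))"
  proof (rule Infinite_Sum.abs_summable_on_comparison_test')
    note cX = has_sum_infsum[OF abs_summable_summable[OF chain_weight_abs_summable[OF q k]]]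
      chain_weight_abs_summable[OF q k]
    have "(\<lambda>r. norm (dixon_coeff q r)) summable_on UNIV"
      using dixon_coeff_abs_summable[OF q] by (intro norm_summable_imp_summable_on) simp
    note has_sum_times(2)[OF has_sum_infsum[OF abs_summable_summable[OF this]] this
        has_sum_times(1)[OF cX cX]]
    from this has_sum_times(2)[OF cX cX]
    have "(\<lambda>(r, n, l). norm (dixon_coeff q r * (chain_weight k q n * chain_weight k q l))) summable_on (UNIV \<times> (X \<times> X))"
      by (simp add: case_prod_unfold X_def)
    then show "(\<lambda>z. (case z of (r, n, l) \<Rightarrow> norm (dixon_coeff q r * (chain_weight k q n * chain_weight k q l))) * (C * C))
       summable_on (UNIV \<times> (X \<times> X))"
      by (rule summable_on_cmult_left)
    fix z :: "nat \<times> (nat \<Rightarrow> nat) \<times> (nat \<Rightarrow> nat)"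
    obtain r n l where z: "z = (r, n, l)" by (metis prod_cases3)
    have "norm (f z) = norm (dixon_coeff q r * (chain_weight k q n * chain_weight k q l))
        * (norm (bailey_kernel q (n 1) r) * norm (bailey_kernel q (l 1) r))"
      by (simp add: f_def z w_def norm_mult)
    also have "\<dots> \<le> norm (dixon_coeff q r * (chain_weight k q n * chain_weight k q l)) * (C * C)"
      by (intro mult_left_mono mult_mono C C0) auto
    finally show "norm (f z) \<le> (case z of (r, n, l) \<Rightarrow> norm (dixon_coeff q r * (chain_weight k q n * chain_weight k q l))) * (C * C)"
      by (simp add: z)
  qed

  define a where "a = q ^ (2 * k)"
  define b where "b = q ^ (2 * k + 1)"
  have ab: "norm a < 1" "norm b < 1"
    unfolding a_def b_def by (rule norm_power_less_one[OF q], use k in simp)+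
  have Q: "a * b = q ^ (4 * k + 1)"
    unfolding a_def b_def power_add[symmetric] by (rule arg_cong[where f = "\<lambda>n. q ^ n"]) simp
  define T where "T = qpoch_inf a (a * b) * qpoch_inf b (a * b) * qpoch_inf (a * b) (a * b)"
  \<comment> \<open>With r outermost, the inner double sum is a product of two instances of
    \<open>bailey_chain\<close>, and the sum over r is the theta series.\<close>
  have "(f has_sum (T * (1 / (qpoch_inf q q)\<^sup>2))) (UNIV \<times> (X \<times> X))"
  proof (rule has_sum_SigmaI)
    fix r :: nat
    have "((\<lambda>y. f (r, y)) has_sum (dixon_coeff q r * (q ^ (k * r\<^sup>2) / qpoch_inf q q * (q ^ (k * r\<^sup>2) / qpoch_inf q q)))) (X \<times> X)"
      using has_sum_cmult_right[OF has_sum_times(1)[OF wX wX]]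
      by (simp add: f_def case_prod_unfold)
    also have "dixon_coeff q r * (q ^ (k * r\<^sup>2) / qpoch_inf q q * (q ^ (k * r\<^sup>2) / qpoch_inf q q))
       = theta_coeff a b r * (1 / (qpoch_inf q q)\<^sup>2)"
      unfolding a_def b_def dixon_coeff_theta_coeff[symmetric] by (simp add: power2_eq_square)
    finally show "((\<lambda>y. f (r, y)) has_sum (theta_coeff a b r * (1 / (qpoch_inf q q)\<^sup>2))) (X \<times> X)" .
  next
    show "((\<lambda>r. theta_coeff a b r * (1 / (qpoch_inf q q)\<^sup>2)) has_sum (T * (1 / (qpoch_inf q q)\<^sup>2))) UNIV"
      unfolding T_def by (rule has_sum_cmult_left[OF jacobi_triple_product[OF ab]])
  qed (rule abs_summable_summable[OF abs_f])
  then have swapped: "((\<lambda>z. f (snd z, fst z)) has_sum (T * (1 / (qpoch_inf q q)\<^sup>2))) ((X \<times> X) \<times> UNIV)"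
    by (subst (asm) has_sum_swap) (simp add: case_prod_unfold)
  have "((\<lambda>(n, l). summand k q n l) has_sum (T * (1 / (qpoch_inf q q)\<^sup>2))) (X \<times> X)"
  proof (rule has_sum_SigmaD[OF swapped])
    fix y :: "(nat \<Rightarrow> nat) \<times> (nat \<Rightarrow> nat)"
    obtain n l where y: "y = (n, l)" by (cases y)
    \<comment> \<open>With r innermost, the kernel vanishes for r > n_1, so the sum over r is finite
      and \<open>dixon_sum\<close> restores the coupling factor.\<close>
    have "summand k q n l = (\<Sum>r\<le>n 1. f (r, n, l))"
      unfolding summand_chain_weight dixon_sum[OF q order_refl, symmetric] sum_distrib_left
      by (intro sum.cong) (simp_all add: f_def w_def)
    then show "((\<lambda>r. f (snd (y, r), fst (y, r))) has_sum (case y of (n, l) \<Rightarrow> summand k q n l)) UNIV"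
      by (intro has_sum_finite_neutralI[of "{..n 1}"])
         (auto simp: y f_def w_def bailey_kernel_def recip_qpoch_def)
  qed
  \<comment> \<open>T equals the product side times (q;q)_inf, which cancels one of the two
    denominators contributed by the chains.\<close>
  moreover have "T * (1 / (qpoch_inf q q)\<^sup>2) = 1 / qpoch_inf q q * product_side k q"
    using qpoch_inf_nonzero[OF q]
    unfolding T_def Q unfolding a_def b_def product_side_triple_product[OF q k, symmetric]
    by (simp add: power2_eq_square)
  ultimately show ?thesis by (simp add: X_def)
qed

end
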